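(* Let $r\ge 2$ be an integer and let $f:X\to Y$ be a retraction map with $f':X'\to Y'$ (as defined in the context). Then $TC_r(f')\le TC_r(f)$.
   Context: All maps are continuous and all spaces are normal topological spaces. Retraction map: let $f:X\to Y$ be a map, $X'\subseteq X$ and $Y'\subseteq Y$ subspaces, with $f(X')\subseteq Y'$, and let $f':=f|_{X'}:X'\to Y'$. One says that $f:X\to Y$ is a retraction map with $f':X'\to Y'$ if there are retractions $r_X:X\to X'$ and $r_Y:Y\to Y'$ (continuous maps with $r_X|_{X'}=\mathrm{id}_{X'}$ and $r_Y|_{Y'}=\mathrm{id}_{Y'}$) such that $r_Y\circ f=f'\circ r_X$. Sequential topological complexity of a map: let $X^r$ be the Cartesian product of $r$ copies of $X$, with elements $\bar x=(x_0,\dots,x_{r-1})$, and let $PY$ be the space of all continuous paths $\gamma:[0,1]\to Y$ (compact-open topology). A sequential $f$-motion planner on a subset $U\subseteq X^r$ is a (continuous) map $f_U:U\to PY$ such that $f_U(\bar x)\left(\frac{j}{r-1}\right)=f(x_j)$ for all $\bar x\in U$ and all $j=0,\dots,r-1$. The sequential topological complexity $TC_r(f)$ is the minimal number $k$ such that $X^r$ is covered by $k+1$ open sets $U_0,\dots,U_k$ on each of which there is a sequential $f$-motion planner; if no such $k$ exists, $TC_r(f)=\infty$. *)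

theory Defs
  imports "HOL-Analysis.Analysis"
begin

text \<open>A map between the topologies \<open>A\<close> and \<open>Y\<close> is represented by a function that is
  \<^const>\<open>undefined\<close> outside \<open>topspace A\<close>, so that equal maps are equal functions.
  The choice \<open>K = {}\<close> makes the set of all continuous maps the underlying set.\<close>

definition compact_open_topology :: "'a topology \<Rightarrow> 'b topology \<Rightarrow> ('a \<Rightarrow> 'b) topology" where
  "compact_open_topology A Y =
     topology_generated_by
       {{\<gamma> \<in> extensional (topspace A). continuous_map A Y \<gamma> \<and> \<gamma> ` K \<subseteq> V} | K V.
          compactin A K \<and> openin Y V}"

lemma topspace_compact_open_topology:
  "topspace (compact_open_topology A Y) = {\<gamma> \<in> extensional (topspace A). continuous_map A Y \<gamma>}"
  (is "_ = ?C")
proof -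
  let ?S = "{{\<gamma> \<in> extensional (topspace A). continuous_map A Y \<gamma> \<and> \<gamma> ` K \<subseteq> V} | K V.
    compactin A K \<and> openin Y V}"
  have "{\<gamma> \<in> extensional (topspace A). continuous_map A Y \<gamma> \<and> \<gamma> ` {} \<subseteq> {}} \<in> ?S"
    using compactin_empty openin_empty by blast
  then have "?C \<in> ?S" by simp
  moreover have "B \<subseteq> ?C" if "B \<in> ?S" for B using that by blast
  ultimately have "\<Union>?S = ?C" by (intro equalityI Union_least Union_upper)
  then show ?thesis
    by (simp only: compact_open_topology_def topology_generated_by_topspace)
qed

definition path_space :: "'a topology \<Rightarrow> (real \<Rightarrow> 'a) topology" where
  "path_space Y = compact_open_topology (top_of_set {0..1}) Y"

definition power_space :: "nat \<Rightarrow> 'a topology \<Rightarrow> (nat \<Rightarrow> 'a) topology" where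
  "power_space r X = product_topology (\<lambda>_. X) {..<r}"

definition seq_motion_planner ::
  "nat \<Rightarrow> 'a topology \<Rightarrow> 'b topology \<Rightarrow> ('a \<Rightarrow> 'b) \<Rightarrow> (nat \<Rightarrow> 'a) set
     \<Rightarrow> ((nat \<Rightarrow> 'a) \<Rightarrow> real \<Rightarrow> 'b) \<Rightarrow> bool" where
  "seq_motion_planner r X Y f U s \<longleftrightarrow>
     U \<subseteq> topspace (power_space r X) \<and>
     continuous_map (subtopology (power_space r X) U) (path_space Y) s \<and>
     (\<forall>x\<in>U. \<forall>j<r. s x (real j / (real r - 1)) = f (x j))"

text \<open>In \<^typ>\<open>enat\<close> the infimum of the empty set is \<open>\<infinity>\<close>.\<close>

definition seq_TC :: "nat \<Rightarrow> 'a topology \<Rightarrow> 'b topology \<Rightarrow> ('a \<Rightarrow> 'b) \<Rightarrow> enat" where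
  "seq_TC r X Y f =
     Inf {enat k | k. \<exists>U :: nat \<Rightarrow> (nat \<Rightarrow> 'a) set.
            (\<forall>i\<le>k. openin (power_space r X) (U i) \<and> (\<exists>s. seq_motion_planner r X Y f (U i) s)) \<and>
            (\<Union>i\<le>k. U i) = topspace (power_space r X)}"

definition retraction_map_with ::
  "'a topology \<Rightarrow> 'b topology \<Rightarrow> ('a \<Rightarrow> 'b) \<Rightarrow> 'a set \<Rightarrow> 'b set \<Rightarrow> ('a \<Rightarrow> 'b) \<Rightarrow> bool" where
  "retraction_map_with X Y f X' Y' f' \<longleftrightarrow>
     continuous_map X Y f \<and> X' \<subseteq> topspace X \<and> Y' \<subseteq> topspace Y \<and> f ` X' \<subseteq> Y' \<and>
     f' = restrict f X' \<and>
     (\<exists>r\<^sub>X r\<^sub>Y.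
        continuous_map X (subtopology X X') r\<^sub>X \<and> (\<forall>x\<in>X'. r\<^sub>X x = x) \<and>
        continuous_map Y (subtopology Y Y') r\<^sub>Y \<and> (\<forall>y\<in>Y'. r\<^sub>Y y = y) \<and>
        (\<forall>x\<in>topspace X. r\<^sub>Y (f x) = f' (r\<^sub>X x)))"

end

theory Submission
  imports Defs
begin

text \<open>
  A retraction map exhibits \<open>f'\<close> as the composite \<open>r\<^sub>Y \<circ> f \<circ> \<iota>\<close>, where \<open>\<iota>\<close> is the inclusion of
  \<open>X'\<close> into \<open>X\<close>: for \<open>x \<in> X'\<close> the retraction square gives \<open>r\<^sub>Y (f x) = f' (r\<^sub>X x) = f' x\<close>.

  Sequential topological complexity cannot grow when a map \<open>f\<close> is replaced by a composite
  \<open>b \<circ> f \<circ> a\<close> (\<open>seq_TC_compose_le\<close>). Given a motion planner \<open>s\<close> for \<open>f\<close> on \<open>U \<subseteq> X\<^sup>r\<close>, let the new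
  planner send a tuple \<open>x\<close> with \<open>a\<^sup>r x \<in> U\<close> to the path \<open>b \<circ> s (a\<^sup>r x)\<close>: at the time \<open>j/(r-1)\<close>
  it visits \<open>b (f (a (x j)))\<close>. Preimages under \<open>a\<^sup>r\<close> turn an open cover of \<open>X\<^sup>r\<close> into an open
  cover with the same number of members, and the new planner is continuous because
  postcomposition with \<open>b\<close> is continuous for the compact-open topology
  (\<open>continuous_map_compact_open_postcompose\<close>).
\<close>

text \<open>A path sends \<open>K\<close> into \<open>V\<close> after composition with \<open>g\<close> exactly if it sends \<open>K\<close> into the
  preimage of \<open>V\<close>, so preimages of subbasic open sets are again subbasic.\<close>

lemma continuous_map_compact_open_postcompose:
  assumes g: "continuous_map Y Z g"
  shows "continuous_map (compact_open_topology A Y) (compact_open_topology A Z)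
           (\<lambda>\<gamma>. restrict (g \<circ> \<gamma>) (topspace A))"
proof -
  let ?S = "\<lambda>K V. {\<gamma> \<in> extensional (topspace A). continuous_map A Z \<gamma> \<and> \<gamma> ` K \<subseteq> V}"
  let ?p = "\<lambda>\<gamma>. restrict (g \<circ> \<gamma>) (topspace A)"
  let ?C = "compact_open_topology A Y"
  have cont: "continuous_map A Z (?p \<gamma>)" if "\<gamma> \<in> topspace ?C" for \<gamma>
  proof (rule continuous_map_eq)
    show "continuous_map A Z (g \<circ> \<gamma>)"
      using that g by (auto simp: topspace_compact_open_topology intro: continuous_map_compose)
  qed simp
  show ?thesis
    unfolding compact_open_topology_def[of A Z]
  proof (rule continuous_on_generated_topo)
    fix B assume "B \<in> {?S K V | K V. compactin A K \<and> openin Z V}"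
    then obtain K V where B: "B = ?S K V" and K: "compactin A K" and V: "openin Z V"
      by blast
    have KA: "K \<subseteq> topspace A"
      using K by (rule compactin_subset_topspace)
    let ?W = "{y \<in> topspace Y. g y \<in> V}"
    have W: "openin Y ?W"
      using g V by (rule openin_continuous_map_preimage)
    have "?p -` B \<inter> topspace ?C =
        {\<gamma> \<in> extensional (topspace A). continuous_map A Y \<gamma> \<and> \<gamma> ` K \<subseteq> ?W}"
    proof (intro equalityI subsetI)
      fix \<gamma> assume "\<gamma> \<in> ?p -` B \<inter> topspace ?C"
      then have *: "\<gamma> \<in> extensional (topspace A)" "continuous_map A Y \<gamma>" "?p \<gamma> ` K \<subseteq> V"
        by (auto simp: B topspace_compact_open_topology)
      then have "\<gamma> ` K \<subseteq> ?W"
        using KA continuous_map_image_subset_topspace[OF *(2)] by fastforce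
      with * show "\<gamma> \<in> {\<gamma> \<in> extensional (topspace A). continuous_map A Y \<gamma> \<and> \<gamma> ` K \<subseteq> ?W}"
        by simp
    next
      fix \<gamma> assume "\<gamma> \<in> {\<gamma> \<in> extensional (topspace A). continuous_map A Y \<gamma> \<and> \<gamma> ` K \<subseteq> ?W}"
      then have *: "\<gamma> \<in> topspace ?C" "\<gamma> ` K \<subseteq> ?W"
        by (auto simp: topspace_compact_open_topology)
      then have "?p \<gamma> ` K \<subseteq> V"
        using KA by fastforce
      with * cont show "\<gamma> \<in> ?p -` B \<inter> topspace ?C"
        by (simp add: B)
    qed
    also have "openin ?C \<dots>"
      unfolding compact_open_topology_def using K W by (intro topology_generated_by_Basis) blast
    finally show "openin ?C (?p -` B \<inter> topspace ?C)" .
  next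
    have "?p ` topspace ?C \<subseteq> topspace (compact_open_topology A Z)"
      using cont by (auto simp: topspace_compact_open_topology)
    then show "?p ` topspace ?C \<subseteq> \<Union>{?S K V | K V. compactin A K \<and> openin Z V}"
      by (simp add: compact_open_topology_def topology_generated_by_topspace)
  qed
qed

lemma continuous_map_power_space:
  assumes "continuous_map X' X a"
  shows "continuous_map (power_space r X') (power_space r X) (\<lambda>x. \<lambda>i\<in>{..<r}. a (x i))"
proof -
  have "continuous_map (product_topology (\<lambda>_. X') {..<r}) X (\<lambda>x. a (x i))" if "i < r" for i
    using continuous_map_compose[OF continuous_map_product_projection[of i "{..<r}" "\<lambda>_. X'"] assms]
      that by (simp add: o_def)
  then show ?thesis
    by (auto simp: power_space_def continuous_map_componentwise)
qed

text \<open>The condition \<open>r \<ge> 2\<close> keeps the prescribed times \<open>j/(r-1)\<close> inside the interval \<open>{0..1}\<close>;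
  outside it the new path has a default value.\<close>

lemma seq_motion_planner_compose:
  fixes a :: "'c \<Rightarrow> 'a" and b :: "'b \<Rightarrow> 'd"
  assumes r: "r \<ge> 2"
    and a: "continuous_map X' X a" and b: "continuous_map Y Y' b"
    and f': "\<And>x. x \<in> topspace X' \<Longrightarrow> f' x = b (f (a x))"
    and s: "seq_motion_planner r X Y f U s"
  defines "p \<equiv> \<lambda>x. \<lambda>i\<in>{..<r}. a (x i)"
  shows "seq_motion_planner r X' Y' f' {x \<in> topspace (power_space r X'). p x \<in> U}
           (\<lambda>x. restrict (b \<circ> s (p x)) {0..1})"
    (is "seq_motion_planner _ _ _ _ ?V _")
  unfolding seq_motion_planner_def
proof (intro conjI ballI allI impI)
  show "?V \<subseteq> topspace (power_space r X')"
    by blast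
  have "continuous_map (subtopology (power_space r X') ?V) (subtopology (power_space r X) U) p"
    using continuous_map_power_space[OF a, of r]
    by (auto simp: p_def continuous_map_in_subtopology intro: continuous_map_from_subtopology)
  moreover have "continuous_map (subtopology (power_space r X) U) (path_space Y) s"
    using s by (simp add: seq_motion_planner_def)
  moreover have "continuous_map (path_space Y) (path_space Y') (\<lambda>\<gamma>. restrict (b \<circ> \<gamma>) {0..1})"
    using continuous_map_compact_open_postcompose[OF b, of "top_of_set {0..1}"]
    by (simp add: path_space_def)
  ultimately have "continuous_map (subtopology (power_space r X') ?V) (path_space Y')
      ((\<lambda>\<gamma>. restrict (b \<circ> \<gamma>) {0..1}) \<circ> (s \<circ> p))"
    by (intro continuous_map_compose)
  then show "continuous_map (subtopology (power_space r X') ?V) (path_space Y')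
      (\<lambda>x. restrict (b \<circ> s (p x)) {0..1})"
    by (simp add: o_def)
next
  fix x j assume x: "x \<in> ?V" and j: "j < r"
  have time: "real j / (real r - 1) \<in> {0..1}"
    using r j by (auto simp: field_simps)
  have "s (p x) (real j / (real r - 1)) = f (a (x j))"
    using s x j by (simp add: seq_motion_planner_def p_def)
  moreover have "x j \<in> topspace X'"
    using x j by (auto simp: power_space_def)
  ultimately show "restrict (b \<circ> s (p x)) {0..1} (real j / (real r - 1)) = f' (x j)"
    using time f' by simp
qed

lemma seq_TC_compose_le:
  fixes a :: "'c \<Rightarrow> 'a" and b :: "'b \<Rightarrow> 'd"
  assumes r: "r \<ge> 2"
    and a: "continuous_map X' X a" and b: "continuous_map Y Y' b"
    and f': "\<And>x. x \<in> topspace X' \<Longrightarrow> f' x = b (f (a x))"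
  shows "seq_TC r X' Y' f' \<le> seq_TC r X Y f"
  unfolding seq_TC_def
proof (rule Inf_superset_mono, clarify)
  fix k :: nat and U :: "nat \<Rightarrow> (nat \<Rightarrow> 'a) set"
  assume U: "\<forall>i\<le>k. openin (power_space r X) (U i) \<and> (\<exists>s. seq_motion_planner r X Y f (U i) s)"
    and cover: "(\<Union>i\<le>k. U i) = topspace (power_space r X)"
  define p where "p = (\<lambda>x. \<lambda>i\<in>{..<r}. a (x i))"
  define V where "V i = {x \<in> topspace (power_space r X'). p x \<in> U i}" for i
  have p: "continuous_map (power_space r X') (power_space r X) p"
    unfolding p_def using a by (rule continuous_map_power_space)
  have "openin (power_space r X') (V i)" if "i \<le> k" for i
    unfolding V_def using p U that by (blast intro: openin_continuous_map_preimage)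
  moreover have "\<exists>s. seq_motion_planner r X' Y' f' (V i) s" if "i \<le> k" for i
    using U that seq_motion_planner_compose[where f = f and f' = f', OF r a b f'] unfolding V_def p_def by blast
  moreover have "(\<Union>i\<le>k. V i) = topspace (power_space r X')"
  proof
    show "topspace (power_space r X') \<subseteq> (\<Union>i\<le>k. V i)"
      using continuous_map_image_subset_topspace[OF p] unfolding cover[symmetric] V_def by blast
  qed (auto simp: V_def)
  ultimately show "\<exists>l. enat k = enat l \<and> (\<exists>V.
      (\<forall>i\<le>l. openin (power_space r X') (V i) \<and> (\<exists>s. seq_motion_planner r X' Y' f' (V i) s)) \<and>
      (\<Union>i\<le>l. V i) = topspace (power_space r X'))"
    by blast
qed

theorem theorem5p3:
  fixes r :: nat
    and X :: "'a topology" and Y :: "'b topology"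
    and f f' :: "'a \<Rightarrow> 'b" and X' :: "'a set" and Y' :: "'b set"
  assumes "r \<ge> 2"
    and "normal_space X" and "normal_space Y"
    and "retraction_map_with X Y f X' Y' f'"
  shows "seq_TC r (subtopology X X') (subtopology Y Y') f' \<le> seq_TC r X Y f"
proof -
  obtain r\<^sub>X r\<^sub>Y where rX: "\<And>x. x \<in> X' \<Longrightarrow> r\<^sub>X x = x"
    and rY: "continuous_map Y (subtopology Y Y') r\<^sub>Y"
    and square: "\<And>x. x \<in> topspace X \<Longrightarrow> r\<^sub>Y (f x) = f' (r\<^sub>X x)"
    using assms(4) unfolding retraction_map_with_def by blast
  have "continuous_map (subtopology X X') X (\<lambda>x. x)"
    by (simp add: continuous_map_from_subtopology)
  moreover have "f' x = r\<^sub>Y (f x)" if "x \<in> topspace (subtopology X X')" for x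
    using that rX square by simp
  ultimately show ?thesis
    using seq_TC_compose_le[OF assms(1) _ rY] by blast
qed

end
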